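(* Let $S=\{i_1<\cdots<i_s\}$ be a finite set of positive integers (not depending on $n$) which is admissible, i.e. $\#P(S;n)\neq 0$ for some $n$. Then there is a polynomial $p(n)=p(S;n)$, depending on $S$, such that $p(n)$ is an integer for every integer $n$ and $$\#P(S;n)=p(n)\,2^{n-\#S-1}$$ for every $n$ for which $\#P(S;n)\neq 0$. Moreover $\deg p(n)=i_s-1$ if $S\neq\emptyset$, and $\deg p(n)=0$ if $S=\emptyset$.
   Context: For $n\ge 1$, $\mathfrak S_n$ is the set of permutations $\pi=a_1\ldots a_n$ of $[n]=\{1,\ldots,n\}$. An index $i$ is a peak of $\pi$ if $a_{i-1}<a_i>a_{i+1}$; the peak set $P(\pi)$ is the set of peaks of $\pi$ (so $P(\pi)\subseteq\{2,\ldots,n-1\}$). For a set $S$ of positive integers, $P(S;n)=\{\pi\in\mathfrak S_n : P(\pi)=S\}$. For a nonempty admissible $S$, $\#P(S;n)\ne 0$ holds exactly for $n\ge \max S+1$. *)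

theory Defs
  imports
    Complex_Main
    "HOL-Combinatorics.Permutations"
    "HOL-Computational_Algebra.Polynomial"
begin

text \<open>
  A permutation \<open>a\<^sub>1 \<dots> a\<^sub>n\<close> of \<open>{1..n}\<close> is the function \<open>\<pi>\<close> with \<open>\<pi> permutes {1..n}\<close> and
  \<open>\<pi> i = a\<^sub>i\<close>. Such a function is the identity outside \<open>{1..n}\<close>, so peaks have to be
  restricted explicitly to the indices \<open>i\<close> whose two neighbours lie in \<open>{1..n}\<close>.
\<close>

definition peak_set :: "nat \<Rightarrow> (nat \<Rightarrow> nat) \<Rightarrow> nat set" where
  "peak_set n \<pi> = {i. 1 < i \<and> i < n \<and> \<pi> (i - 1) < \<pi> i \<and> \<pi> i > \<pi> (i + 1)}"

definition perms_with_peak_set :: "nat set \<Rightarrow> nat \<Rightarrow> (nat \<Rightarrow> nat) set" where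
  "perms_with_peak_set S n = {\<pi>. \<pi> permutes {1..n} \<and> peak_set n \<pi> = S}"

definition admissible :: "nat set \<Rightarrow> bool" where
  "admissible S \<longleftrightarrow> (\<exists>n\<ge>1. card (perms_with_peak_set S n) \<noteq> 0)"

end

theory Submission
  imports Defs "HOL-Combinatorics.Multiset_Permutations" "HOL-Library.Infinite_Set"
begin

text \<open>
  Let \<open>m = Max S\<close>, \<open>k = m - 1\<close> and \<open>R = S - {m}\<close>, and count the permutations of \<open>{1..n}\<close> whose
  first \<open>k\<close> letters have peak set \<open>R\<close> and whose last \<open>n - k\<close> letters have no peak. Choosing the
  letters of the first block gives \<open>(n choose k) #P(R;k) 2^(n-k-1)\<close>, because a word on \<open>l\<close> letters
  without peaks has its largest letter at one of its ends and hence there are \<open>2^(l-1)\<close> of them.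
  On the other hand the peak set of such a permutation is \<open>R\<close>, \<open>R \<union> {k}\<close> or \<open>R \<union> {k + 1} = S\<close>,
  since two adjacent positions are never both peaks.
  This expresses \<open>p(S;n)\<close> as \<open>p(R;k) (n choose k) - 2 p(R;n) - p(R \<union> {k};n)\<close>, and by induction on
  \<open>Max S\<close> the last two terms have degree below \<open>k\<close>. Peak counts do not change when the letters
  are relabelled monotonically, so they are computed with lists over arbitrary finite sets.
\<close>

section \<open>Peaks of words under cutting and relabelling\<close>

text \<open>The index \<open>i\<close> is 1-based, as in \<^const>\<open>peak_set\<close>: the \<open>i\<close>-th letter is \<open>xs ! (i - 1)\<close>.\<close>

definition list_peaks :: "nat list \<Rightarrow> nat set" where
  "list_peaks xs =
     {i. 1 < i \<and> i < length xs \<and> xs ! (i - 2) < xs ! (i - 1) \<and> xs ! i < xs ! (i - 1)}"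

definition peak_lists :: "nat set \<Rightarrow> nat set \<Rightarrow> nat list set" where
  "peak_lists S A = {xs \<in> permutations_of_set A. list_peaks xs = S}"

definition peak_count :: "nat set \<Rightarrow> nat \<Rightarrow> nat" where
  "peak_count S n = card (peak_lists S {..<n})"

lemma finite_peak_lists [simp]: "finite (peak_lists S A)"
  by (simp add: peak_lists_def)

lemma list_peaks_bounds: "i \<in> list_peaks xs \<Longrightarrow> 1 < i \<and> i < length xs"
  by (simp add: list_peaks_def)

lemma list_peaks_not_consecutive:
  assumes "i \<in> list_peaks xs"
  shows "Suc i \<notin> list_peaks xs"
  using assms by (auto simp: list_peaks_def)

lemma list_peaks_take:
  assumes "k \<le> length xs"
  shows "list_peaks (take k xs) = {i \<in> list_peaks xs. i < k}"
  using assms by (auto simp: list_peaks_def)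

text \<open>A peak of \<open>xs\<close> at \<open>k + 1\<close> loses its left neighbour in the cut,
  which is why \<open>1 < i\<close> has to be demanded.\<close>

lemma list_peaks_drop:
  assumes "k \<le> length xs"
  shows "list_peaks (drop k xs) = {i. 1 < i \<and> i + k \<in> list_peaks xs}"
proof -
  have "drop k xs ! (i - 2) = xs ! (i + k - 2) \<and> drop k xs ! (i - 1) = xs ! (i + k - 1)
      \<and> drop k xs ! i = xs ! (i + k)" if "1 < i" for i
  proof -
    have "k + (i - 2) = i + k - 2" "k + (i - 1) = i + k - 1" "k + i = i + k"
      using that by auto
    then show ?thesis using assms by (metis nth_drop)
  qed
  then show ?thesis using assms by (auto simp: list_peaks_def)
qed

lemma list_peaks_map:
  assumes "strict_mono_on A f" and "set xs \<subseteq> A"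
  shows "list_peaks (map f xs) = list_peaks xs"
proof -
  have "f x < f y \<longleftrightarrow> x < y" if "x \<in> set xs" "y \<in> set xs" for x y
    using that assms by (meson strict_mono_on_less subsetD)
  then show ?thesis by (auto simp: list_peaks_def)
qed

section \<open>Counting over arbitrary finite alphabets\<close>

text \<open>The increasing bijection from \<open>{..<card A}\<close> onto \<open>A\<close> preserves
  all comparisons of letters, so only the size of the alphabet matters.\<close>

lemma card_peak_lists:
  assumes "finite A"
  shows "card (peak_lists S A) = peak_count S (card A)"
proof -
  obtain h where h: "bij_betw h {..<card A} A" "strict_mono_on {..<card A} h"
    using ex_bij_betw_strict_mono_card[OF assms] by blast
  have inj: "inj_on h {..<card A}" and im: "h ` {..<card A} = A"
    using h(1) by (auto simp: bij_betw_def)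
  have "peak_lists S A = map h ` peak_lists S {..<card A}"
  proof -
    have "permutations_of_set A = map h ` permutations_of_set {..<card A}"
      using permutations_of_set_image_inj[OF inj] im by simp
    moreover have "list_peaks (map h xs) = list_peaks xs"
      if "xs \<in> permutations_of_set {..<card A}" for xs
      using list_peaks_map[OF h(2)] permutations_of_setD(1)[OF that] by auto
    ultimately show ?thesis
      by (auto simp: peak_lists_def)
  qed
  moreover have "inj_on (map h) (peak_lists S {..<card A})"
  proof (rule inj_on_subset)
    show "inj_on (map h) (lists {..<card A})"
      using inj by (rule inj_on_map_lists)
    show "peak_lists S {..<card A} \<subseteq> lists {..<card A}"
      using permutations_of_set_lists by (auto simp: peak_lists_def)
  qed
  ultimately show ?thesis
    by (simp add: peak_count_def card_image)
qed

text \<open>One-line notation is a peak-preserving bijection onto words, so the rest of the argument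
  can count lists.\<close>

lemma card_perms_with_peak_set:
  "card (perms_with_peak_set S n) = peak_count S n"
proof -
  let ?f = "\<lambda>\<pi>::nat \<Rightarrow> nat. map \<pi> [1..<Suc n]"
  have inj: "inj_on ?f {\<pi>. \<pi> permutes {1..n}}"
  proof (rule inj_onI)
    fix p q :: "nat \<Rightarrow> nat"
    assume pq: "p \<in> {\<pi>. \<pi> permutes {1..n}}" "q \<in> {\<pi>. \<pi> permutes {1..n}}" "?f p = ?f q"
    show "p = q"
    proof
      fix x
      show "p x = q x"
      proof (cases "x \<in> {1..n}")
        case True
        then show ?thesis using pq(3) by (auto simp del: upt_Suc)
      next
        case False
        then show ?thesis using pq(1,2) by (simp add: permutes_not_in)
      qed
    qed
  qed
  have sub: "?f ` {\<pi>. \<pi> permutes {1..n}} \<subseteq> permutations_of_set {1..n}"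
  proof (clarify, rule permutations_of_setI)
    fix p :: "nat \<Rightarrow> nat" assume p: "p permutes {1..n}"
    have *: "set [1..<Suc n] = {1..n}" by auto
    show "set (?f p) = {1..n}"
      unfolding set_map * by (rule permutes_image[OF p])
    show "distinct (?f p)"
      unfolding distinct_map by (auto intro: permutes_inj_on[OF p])
  qed
  \<comment> \<open>By injectivity the image has \<open>fact n\<close> elements, as many as there
    are orderings of \<open>{1..n}\<close>, so the inclusion is an equality.\<close>
  have eq: "?f ` {\<pi>. \<pi> permutes {1..n}} = permutations_of_set {1..n}"
    using sub by (rule card_subset_eq[rotated])
      (simp_all only: card_image[OF inj], simp_all add: card_permutations)
  have pk: "list_peaks (?f p) = peak_set n p" for p
  proof -
    have "?f p ! (i - 2) = p (i - 1) \<and> ?f p ! (i - 1) = p i \<and> ?f p ! i = p (i + 1)"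
      if "1 < i" "i < n" for i
    proof -
      have "1 + (i - 2) = i - 1" "1 + (i - 1) = i" using that by auto
      then show ?thesis using that by (simp del: upt_Suc)
    qed
    then show ?thesis by (auto simp: list_peaks_def peak_set_def simp del: upt_Suc)
  qed
  have "?f ` perms_with_peak_set S n = peak_lists S {1..n}"
    unfolding perms_with_peak_set_def peak_lists_def eq[symmetric] using pk by blast
  moreover have "inj_on ?f (perms_with_peak_set S n)"
    by (rule inj_on_subset[OF inj]) (auto simp: perms_with_peak_set_def)
  ultimately have "card (perms_with_peak_set S n) = card (peak_lists S {1..n})"
    by (metis card_image)
  then show ?thesis by (simp add: card_peak_lists)
qed

section \<open>Words without peaks\<close>

text \<open>Position 2 is no peak because the letter before it is larger; from position 3 on the
  comparisons are those of \<open>ys\<close>, one place later.\<close>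

lemma list_peaks_Cons_max:
  assumes "\<forall>y\<in>set ys. y < x"
  shows "list_peaks (x # ys) = Suc ` list_peaks ys"
proof (rule set_eqI)
  fix i
  show "i \<in> list_peaks (x # ys) \<longleftrightarrow> i \<in> Suc ` list_peaks ys"
  proof (cases "i < 3")
    case True
    have "ys \<noteq> [] \<longrightarrow> \<not> x < ys ! 0" using assms by (simp add: not_less less_imp_le)
    then have "i \<notin> list_peaks (x # ys)" using True
      by (auto simp: list_peaks_def numeral_3_eq_3 less_Suc_eq)
    moreover have "i \<notin> Suc ` list_peaks ys" using True
      by (auto simp: list_peaks_def)
    ultimately show ?thesis by blast
  next
    case False
    then obtain j where "i = Suc (Suc (Suc j))"
      by (metis numeral_3_eq_3 not_less le_Suc_ex add_Suc)
    then show ?thesis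
      by (auto simp: list_peaks_def image_iff)
  qed
qed

text \<open>The old last letter stays a non-peak, being followed by a larger one, and the new last
  letter has no right neighbour.\<close>

lemma list_peaks_snoc_max:
  assumes "\<forall>y\<in>set ys. y < x"
  shows "list_peaks (ys @ [x]) = list_peaks ys"
proof (rule set_eqI)
  fix i
  consider "i < length ys" | "i = length ys" | "i > length ys" by linarith
  then show "i \<in> list_peaks (ys @ [x]) \<longleftrightarrow> i \<in> list_peaks ys"
  proof cases
    case 2
    have "ys \<noteq> [] \<longrightarrow> \<not> x < ys ! (length ys - 1)"
      using assms by (simp add: not_less less_imp_le)
    with 2 show ?thesis by (auto simp: list_peaks_def nth_append)
  qed (auto simp: list_peaks_def nth_append)
qed

text \<open>Removing the largest letter, which sits at one of the two ends, leaves a peak-free word;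
  so each further letter doubles the count.\<close>

lemma peak_count_empty: "peak_count {} (Suc n) = 2 ^ n"
proof (induction n)
  case 0
  have "peak_lists {} {..<Suc 0} = {[0]}"
    by (auto simp: peak_lists_def list_peaks_def lessThan_Suc)
  then show ?case by (simp add: peak_count_def)
next
  case (Suc n)
  let ?m = "Suc n"
  let ?L = "peak_lists {} {..<Suc n}"
  have L: "set ys = {..<?m}" "distinct ys" "list_peaks ys = {}" if "ys \<in> ?L" for ys
    using that by (auto simp: peak_lists_def dest: permutations_of_setD)
  have "peak_lists {} {..<Suc ?m} = (#) ?m ` ?L \<union> (\<lambda>ys. ys @ [?m]) ` ?L" (is "?A = ?B \<union> ?C")
  proof
    show "?B \<union> ?C \<subseteq> ?A"
    proof (intro Un_least image_subsetI)
      fix ys assume ys: "ys \<in> ?L"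
      have lt: "\<forall>y\<in>set ys. y < ?m" using L(1)[OF ys] by auto
      show "?m # ys \<in> ?A" "ys @ [?m] \<in> ?A"
        using L[OF ys] lt list_peaks_Cons_max[OF lt] list_peaks_snoc_max[OF lt]
        by (auto simp: peak_lists_def permutations_of_set_def)
    qed
  next
    show "?A \<subseteq> ?B \<union> ?C"
    proof
      fix xs assume "xs \<in> ?A"
      then have xs: "set xs = {..<Suc ?m}" "distinct xs" "list_peaks xs = {}"
        by (auto simp: peak_lists_def dest: permutations_of_setD)
      then have "?m \<in> set xs" by simp
      then obtain us vs where uv: "xs = us @ ?m # vs"
        by (meson split_list)
      have "set us \<union> set vs = set xs - {?m}" using xs(2) uv by auto
      also have "\<dots> = {..<?m}" unfolding xs(1) by auto
      finally have un: "set us \<union> set vs = {..<?m}" .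
      then have lt: "\<forall>y\<in>set us. y < ?m" "\<forall>y\<in>set vs. y < ?m" by blast+
      \<comment> \<open>With letters on both sides, the largest letter would be a peak, at the
        1-based position \<open>Suc (length us)\<close>.\<close>
      have "us = [] \<or> vs = []"
      proof (rule ccontr)
        assume "\<not> (us = [] \<or> vs = [])"
        then have ne: "us \<noteq> []" "vs \<noteq> []" by auto
        have "xs ! (length us - 1) < ?m" 
          using ne lt(1) by (simp add: uv nth_append)
        moreover have "xs ! length us = ?m" by (simp add: uv nth_append)
        moreover have "xs ! (Suc (length us)) < ?m"
          using ne lt(2) by (simp add: uv nth_append)
        ultimately have "Suc (length us) \<in> list_peaks xs"
          using ne by (simp add: list_peaks_def uv)
        then show False using xs(3) by simp
      qed
      then show "xs \<in> ?B \<union> ?C"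
      proof
        assume us: "us = []"
        then have "vs \<in> ?L"
          using xs uv un lt list_peaks_Cons_max[OF lt(2)]
          by (auto simp: peak_lists_def intro!: permutations_of_setI)
        then show ?thesis using uv us by auto
      next
        assume vs: "vs = []"
        then have "us \<in> ?L"
          using xs uv un lt list_peaks_snoc_max[OF lt(1)]
          by (auto simp: peak_lists_def intro!: permutations_of_setI)
        then show ?thesis using uv vs by auto
      qed
    qed
  qed
  \<comment> \<open>Here it matters that the words in \<open>?L\<close> are nonempty: for the empty
    word both insertions would give \<open>[?m]\<close>.\<close>
  moreover have "?B \<inter> ?C = {}"
  proof -
    have False if "?m # ys = zs @ [?m]" "ys \<in> ?L" "zs \<in> ?L" for ys zs
      using that L(1)[OF that(2)] L(1)[OF that(3)] by (cases zs) auto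
    then show ?thesis by auto
  qed
  moreover have "card ?B = card ?L" "card ?C = card ?L"
    by (auto intro!: card_image inj_onI)
  ultimately have "peak_count {} (Suc ?m) = 2 * peak_count {} ?m"
    unfolding peak_count_def by (simp add: card_Un_disjoint)
  then show ?case using Suc.IH by simp
qed

section \<open>Cutting a word into two blocks\<close>

text \<open>Once the set \<open>B\<close> of letters of the first block is chosen, the two blocks
  are ordered independently, over alphabets of sizes \<open>k\<close> and
  \<open>n - k\<close>.\<close>

lemma card_lists_split_peaks:
  assumes "k \<le> n"
  shows "card {xs \<in> permutations_of_set {..<n}. list_peaks (take k xs) = S \<and> list_peaks (drop k xs) = T}
    = (n choose k) * peak_count S k * peak_count T (n - k)" (is "card ?P = _")
proof -
  let ?\<B> = "{B. B \<subseteq> {..<n} \<and> card B = k}"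
  let ?D = "SIGMA B:?\<B>. peak_lists S B \<times> peak_lists T ({..<n} - B)"
  have "bij_betw (\<lambda>(B, ys, zs). ys @ zs) ?D ?P"
  proof (rule bij_betw_byWitness[where f' = "\<lambda>xs. (set (take k xs), take k xs, drop k xs)"])
    have len: "length ys = card B" if "ys \<in> peak_lists U B" for ys U B
      using that by (auto simp: peak_lists_def permutations_of_set_def distinct_card)
    have st: "set ys = B" if "ys \<in> peak_lists U B" for ys U B
      using that by (auto simp: peak_lists_def permutations_of_set_def)
    show "\<forall>a\<in>?D. (\<lambda>xs. (set (take k xs), take k xs, drop k xs)) ((\<lambda>(B, ys, zs). ys @ zs) a) = a"
      using len st by fastforce
    show "\<forall>xs\<in>?P. (\<lambda>(B, ys, zs). ys @ zs) ((\<lambda>xs. (set (take k xs), take k xs, drop k xs)) xs) = xs"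
      by simp
    show "(\<lambda>(B, ys, zs). ys @ zs) ` ?D \<subseteq> ?P"
    proof clarify
      fix B ys zs
      assume *: "B \<subseteq> {..<n}" "k = card B" "ys \<in> peak_lists S B" "zs \<in> peak_lists T ({..<n} - B)"
      have "distinct (ys @ zs)"
        using * st[OF *(3)] st[OF *(4)] by (auto simp: peak_lists_def permutations_of_set_def)
      then show "ys @ zs \<in> permutations_of_set {..<n} \<and>
          list_peaks (take (card B) (ys @ zs)) = S \<and> list_peaks (drop (card B) (ys @ zs)) = T"
        using * st[OF *(3)] st[OF *(4)] len[OF *(3)]
        by (auto simp: peak_lists_def intro!: permutations_of_setI)
    qed
    show "(\<lambda>xs. (set (take k xs), take k xs, drop k xs)) ` ?P \<subseteq> ?D"
    proof (rule image_subsetI)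
      fix xs assume "xs \<in> ?P"
      then have xs: "xs \<in> permutations_of_set {..<n}"
        and ST: "list_peaks (take k xs) = S" "list_peaks (drop k xs) = T" by auto
      have d: "distinct xs" "set xs = {..<n}" using xs by (auto dest: permutations_of_setD)
      then have "length xs = n" using distinct_card[of xs] by simp
      then have "card (set (take k xs)) = k"
        using d assms by (simp add: distinct_card)
      moreover have "set (take k xs) \<subseteq> {..<n}" using d set_take_subset by metis
      moreover have "set (drop k xs) = {..<n} - set (take k xs)"
      proof -
        have "set (take k xs) \<union> set (drop k xs) = {..<n}"
          by (metis d(2) append_take_drop_id set_append)
        moreover have "set (take k xs) \<inter> set (drop k xs) = {}"
          using d(1) by (simp add: set_take_disj_set_drop_if_distinct)
        ultimately show ?thesis by blast
      qed
      ultimately show "(set (take k xs), take k xs, drop k xs) \<in> ?D"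
        using d(1) ST by (auto simp: peak_lists_def permutations_of_set_def)
    qed
  qed
  then have "card ?P = card ?D" by (simp add: bij_betw_same_card)
  also have "\<dots> = (\<Sum>B\<in>?\<B>. card (peak_lists S B) * card (peak_lists T ({..<n} - B)))"
    by (subst card_SigmaI) (auto simp: card_cartesian_product)
  also have "\<dots> = (\<Sum>B\<in>?\<B>. peak_count S k * peak_count T (n - k))"
  proof (rule sum.cong)
    fix B assume B: "B \<in> ?\<B>"
    then have "finite B" using finite_subset by blast
    moreover have "card ({..<n} - B) = n - k"
      using B \<open>finite B\<close> by (simp add: card_Diff_subset)
    ultimately show "card (peak_lists S B) * card (peak_lists T ({..<n} - B)) =
        peak_count S k * peak_count T (n - k)"
      using B by (simp add: card_peak_lists)
  qed simp
  also have "\<dots> = (n choose k) * peak_count S k * peak_count T (n - k)"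
    using n_subsets[of "{..<n}" k] by simp
  finally show ?thesis .
qed

lemma peak_count_nonzeroE:
  assumes "peak_count S n \<noteq> 0"
  obtains xs where "length xs = n" "distinct xs" "list_peaks xs = S"
proof -
  have "peak_lists S {..<n} \<noteq> {}"
    using assms by (auto simp: peak_count_def)
  then obtain xs where "xs \<in> permutations_of_set {..<n}" "list_peaks xs = S"
    by (auto simp: peak_lists_def)
  then show thesis
    using that[of xs] by (auto simp: length_finite_permutations_of_set dest: permutations_of_setD)
qed

text \<open>Any word with distinct letters witnesses its own peak set. This is applied below to a
  prefix, whose letters need not form an initial segment.\<close>

lemma peak_count_list_peaks:
  assumes "distinct xs"
  shows "peak_count (list_peaks xs) (length xs) \<noteq> 0"
proof -
  have "xs \<in> peak_lists (list_peaks xs) (set xs)"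
    using assms by (auto simp: peak_lists_def)
  then have "card (peak_lists (list_peaks xs) (set xs)) \<noteq> 0"
    by (metis card_0_eq empty_iff finite_peak_lists)
  then show ?thesis
    using assms by (simp add: card_peak_lists distinct_card)
qed

text \<open>Both sides count the words whose first \<open>k\<close> letters have peak set
  \<open>R\<close> and whose remaining letters have no peak. The block conditions leave only
  positions \<open>k\<close> and \<open>k + 1\<close> undecided, and at most one of these is a
  peak.\<close>

lemma peak_count_recurrence:
  assumes "k < n" and R: "\<forall>i\<in>R. i < k"
  shows "peak_count R n + peak_count (insert k R) n + peak_count (insert (Suc k) R) n
    = (n choose k) * peak_count R k * 2 ^ (n - k - 1)"
proof -
  let ?L = "\<lambda>S. peak_lists S {..<n}"
  let ?P = "{xs \<in> permutations_of_set {..<n}. list_peaks (take k xs) = R \<and> list_peaks (drop k xs) = {}}"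
  have "list_peaks (take k xs) = R \<and> list_peaks (drop k xs) = {} \<longleftrightarrow>
      list_peaks xs = R \<or> list_peaks xs = insert k R \<or> list_peaks xs = insert (Suc k) R"
    if "xs \<in> permutations_of_set {..<n}" for xs
  proof -
    have k: "k \<le> length xs"
      using that assms(1) by (simp add: length_finite_permutations_of_set)
    \<comment> \<open>The last block sees exactly the peaks beyond \<open>Suc k\<close>; position
      \<open>Suc k\<close> itself is its first letter.\<close>
    have drop_iff: "list_peaks (drop k xs) = {} \<longleftrightarrow> (\<forall>i\<in>list_peaks xs. i \<le> Suc k)"
    proof
      assume *: "list_peaks (drop k xs) = {}"
      show "\<forall>i\<in>list_peaks xs. i \<le> Suc k"
      proof (rule ccontr)
        assume "\<not> ?thesis"
        then obtain i where "i \<in> list_peaks xs" "i > Suc k" by auto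
        then have "i - k \<in> list_peaks (drop k xs)"
          unfolding list_peaks_drop[OF k] by simp
        with * show False by simp
      qed
    qed (auto simp: list_peaks_drop[OF k])
    have "\<not> (k \<in> list_peaks xs \<and> Suc k \<in> list_peaks xs)"
      using list_peaks_not_consecutive by blast
    moreover have "list_peaks xs = R \<union> list_peaks xs \<inter> {k, Suc k}"
      if "{i \<in> list_peaks xs. i < k} = R" "\<forall>i\<in>list_peaks xs. i \<le> Suc k"
      using that by (auto simp: le_Suc_eq le_less)
    moreover have "{i \<in> list_peaks xs. i < k} = R \<and> (\<forall>i\<in>list_peaks xs. i \<le> Suc k)"
      if "list_peaks xs = R \<or> list_peaks xs = insert k R \<or> list_peaks xs = insert (Suc k) R"
      using that R by fastforce
    ultimately show ?thesis
      unfolding drop_iff list_peaks_take[OF k] by blast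
  qed
  then have "?P = ?L R \<union> ?L (insert k R) \<union> ?L (insert (Suc k) R)"
    unfolding peak_lists_def by blast
  moreover have "R \<noteq> insert k R" "R \<noteq> insert (Suc k) R" "insert k R \<noteq> insert (Suc k) R"
    using R by force+
  then have "?L R \<inter> ?L (insert k R) = {}"
    "(?L R \<union> ?L (insert k R)) \<inter> ?L (insert (Suc k) R) = {}"
    unfolding peak_lists_def by blast+
  ultimately have "card ?P = peak_count R n + peak_count (insert k R) n + peak_count (insert (Suc k) R) n"
    unfolding peak_count_def by (simp add: card_Un_disjoint)
  moreover have "peak_count {} (n - k) = 2 ^ (n - k - 1)"
    using peak_count_empty[of "n - k - 1"] assms(1) by (simp add: Suc_diff_Suc)
  ultimately show ?thesis
    using card_lists_split_peaks[of k n R "{}"] assms(1) by simp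
qed

section \<open>Integer-valued polynomials for peak counts\<close>

text \<open>The binomial coefficient as a polynomial in its upper argument; it is the source of the
  exact degree, and it takes integer values at integers.\<close>

definition gbinomial_poly :: "nat \<Rightarrow> 'a :: field_char_0 poly" where
  "gbinomial_poly k = smult (1 / fact k) (\<Prod>i<k. [:- of_nat i, 1:])"

lemma poly_gbinomial_poly: "poly (gbinomial_poly k) x = x gchoose k"
  by (simp add: gbinomial_poly_def gbinomial_prod_rev poly_prod atLeast0LessThan)

lemma degree_gbinomial_poly: "degree (gbinomial_poly k) = k"
  by (simp add: gbinomial_poly_def degree_prod_eq_sum_degree)

text \<open>The formula is demanded for all \<open>n\<close> beyond the elements of
  \<open>S\<close>, not only where the count is nonzero. Inadmissible sets can thus enter the
  recurrence, with the zero polynomial. The integer exponent avoids truncated subtraction.\<close>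

definition is_peak_poly :: "nat set \<Rightarrow> real poly \<Rightarrow> bool" where
  "is_peak_poly S p \<longleftrightarrow>
    (\<forall>k :: int. poly p (of_int k) \<in> \<int>) \<and>
    (\<forall>n\<ge>1. (\<forall>i\<in>S. i < n) \<longrightarrow>
      real (peak_count S n) = poly p (real n) * 2 powi (int n - int (card S) - 1))"

lemma is_peak_poly_empty: "is_peak_poly {} 1"
proof -
  have "real (peak_count {} n) = 2 powi (int n - 1)" if "n \<ge> 1" for n
  proof -
    obtain m where "n = Suc m" using \<open>n \<ge> 1\<close> by (cases n) auto
    then show ?thesis by (simp add: peak_count_empty)
  qed
  then show ?thesis by (simp add: is_peak_poly_def)
qed

text \<open>This is \<open>peak_count_recurrence\<close> solved for the third count, with the common
  power of 2 divided out.\<close>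

lemma is_peak_poly_step:
  assumes "finite R" and R: "\<forall>i\<in>R. i < k" and "k \<ge> 1"
    and p: "is_peak_poly R p" and q: "is_peak_poly (insert k R) q"
  shows "is_peak_poly (insert (Suc k) R)
    (smult (poly p (real k)) (gbinomial_poly k) - smult 2 p - q)" (is "is_peak_poly ?S ?r")
  unfolding is_peak_poly_def
proof (intro conjI allI impI)
  fix j :: int
  have "(of_int j :: real) gchoose k \<in> \<int>"
    by (simp flip: of_int_gbinomial)
  moreover have "poly p (real k) \<in> \<int>"
    using p unfolding is_peak_poly_def by (metis of_int_of_nat_eq)
  moreover have "poly p (of_int j) \<in> \<int>" "poly q (of_int j) \<in> \<int>"
    using p q unfolding is_peak_poly_def by auto
  ultimately show "poly ?r (of_int j) \<in> \<int>"
    by (simp add: poly_gbinomial_poly)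
next
  fix n assume "n \<ge> 1" and "\<forall>i\<in>?S. i < n"
  then have n: "Suc k < n" by simp
  define c where "c = card R"
  have cS: "card ?S = Suc c" "card (insert k R) = Suc c"
    using assms(1) R unfolding c_def by (subst card_insert_disjoint; force)+
  \<comment> \<open>The power of 2 belonging to \<open>Suc c\<close> peaks at length
    \<open>n\<close>; the set \<open>R\<close> has one element fewer and so gets
    \<open>2 * t\<close>.\<close>
  define t :: real where "t = 2 powi (int n - int c - 2)"
  have t1: "2 powi (int n - int c - 1) = 2 * t"
    using power_int_add_1[of "2::real" "int n - int c - 2"] by (simp add: t_def)
  have "\<forall>i\<in>R. i < n" using R n by force
  then have pn: "real (peak_count R n) = poly p (real n) * (2 * t)"
    using p n unfolding is_peak_poly_def t1[symmetric] c_def by auto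
  have pk: "real (peak_count R k) = poly p (real k) * 2 powi (int k - int c - 1)"
    using p R \<open>k \<ge> 1\<close> unfolding is_peak_poly_def c_def by auto
  have "\<forall>i\<in>insert k R. i < n" using R n by force
  then have qn: "real (peak_count (insert k R) n) = poly q (real n) * t"
    using q n unfolding is_peak_poly_def cS t_def by (auto simp: algebra_simps)
  \<comment> \<open>The exponents \<open>k - c - 1\<close> from the first block and
    \<open>n - k - 1\<close> from the peak-free block add up to that of \<open>t\<close>.\<close>
  have "2 powi (int k - int c - 1) * (2::real) ^ (n - k - 1) = t"
  proof -
    have "(2::real) ^ (n - k - 1) = 2 powi (int n - int k - 1)"
      using n by (simp flip: power_int_of_nat add: algebra_simps)
    then show ?thesis
      unfolding t_def by (simp flip: power_int_add add: algebra_simps)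
  qed
  then have "real ((n choose k) * peak_count R k * 2 ^ (n - k - 1))
      = (real n gchoose k) * poly p (real k) * t"
    by (simp add: pk binomial_gbinomial mult.assoc)
  moreover have "peak_count R n + peak_count (insert k R) n + peak_count ?S n
      = (n choose k) * peak_count R k * 2 ^ (n - k - 1)"
    using peak_count_recurrence[of k n R] R n by simp
  ultimately have "real (peak_count R n) + real (peak_count (insert k R) n) + real (peak_count ?S n)
      = (real n gchoose k) * poly p (real k) * t"
    by (metis of_nat_add)
  then have "real (peak_count ?S n) = poly ?r (real n) * t"
    by (simp add: pn qn poly_gbinomial_poly algebra_simps)
  then show "real (peak_count ?S n) = poly ?r (real n) * 2 powi (int n - int (card ?S) - 1)"
    unfolding cS t_def by (simp add: algebra_simps)
qed

section \<open>Induction on the largest peak\<close>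

text \<open>Only the binomial term reaches degree \<open>k = Max S - 1\<close>: the elements of
  \<open>R\<close> and \<open>insert k R\<close> are at most \<open>k\<close>, so their polynomials
  have degree below \<open>k\<close>.\<close>

lemma exists_peak_poly:
  assumes "finite S" and "peak_count S n \<noteq> 0"
  shows "\<exists>p. is_peak_poly S p \<and> degree p = (if S = {} then 0 else Max S - 1)"
  using assms
\<comment> \<open>Inserting 0 gives the measure a value at the empty set and leaves it unchanged on
  nonempty sets.\<close>
proof (induction "Max (insert 0 S)" arbitrary: S n rule: less_induct)
  case less
  show ?case
  proof (cases "S = {}")
    case True
    then show ?thesis using is_peak_poly_empty by (intro exI[of _ 1]) simp
  next
    case False
    obtain xs where xs: "length xs = n" "distinct xs" "list_peaks xs = S"
      using less.prems(2) by (rule peak_count_nonzeroE)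
    define k where "k = Max S - 1"
    define R where "R = S - {Max S}"
    have "Max S \<in> S" using less.prems(1) False by simp
    then have "1 < Max S" "Max S < n" using xs list_peaks_bounds by blast+
    then have m: "Max S = Suc k" and "k \<ge> 1" by (auto simp: k_def)
    have S: "S = insert (Suc k) R" using \<open>Max S \<in> S\<close> m by (auto simp: R_def)
    have finR: "finite R" using less.prems(1) by (simp add: R_def)
    have Rk: "i < k" if "i \<in> R" for i
    proof -
      have "i \<in> S" "i \<noteq> Suc k" using that m by (auto simp: R_def)
      then have "i \<le> k" using Max_ge[OF less.prems(1)] m by (metis le_SucE)
      moreover have "k \<notin> S" using list_peaks_not_consecutive \<open>Max S \<in> S\<close> xs(3) m by metis
      ultimately show ?thesis using \<open>i \<in> S\<close> by (metis le_neq_implies_less)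
    qed
    \<comment> \<open>The prefix of length \<open>k\<close> loses just the peak at
      \<open>Suc k\<close>. It shows that \<open>R\<close> occurs at length \<open>k\<close>, which
      gives both the induction hypothesis for \<open>R\<close> and a nonzero leading
      coefficient.\<close>
    have "list_peaks (take k xs) = R"
      using list_peaks_take[of k xs] xs S Rk m \<open>Max S < n\<close> by auto
    then have Rk0: "peak_count R k \<noteq> 0"
      using peak_count_list_peaks[of "take k xs"] xs m \<open>Max S < n\<close> by (simp add: min_def)
    have MS: "Max (insert 0 S) = Suc k" using False less.prems(1) m by simp
    have "Max (insert 0 R) < Suc k"
      using finR Rk by (subst Max_less_iff) (auto intro: less_SucI)
    then obtain p where p: "is_peak_poly R p" "degree p = (if R = {} then 0 else Max R - 1)"
      using less.hyps[of R k] MS finR Rk0 by metis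
    have degp: "degree p < k"
    proof (cases "R = {}")
      case True
      then show ?thesis using p(2) \<open>k \<ge> 1\<close> by simp
    next
      case False
      then have "Max R < k" using Rk finR by simp
      then show ?thesis using p(2) False by simp
    qed
    \<comment> \<open>The set \<open>insert k R\<close> need not occur as a peak set, for example
      when \<open>k = 1\<close> or \<open>k - 1 \<in> R\<close>; all its counts are then zero and
      the zero polynomial serves.\<close>
    have "\<exists>q. is_peak_poly (insert k R) q \<and> degree q < k"
    proof (cases "\<exists>n. peak_count (insert k R) n \<noteq> 0")
      case True
      have "Max (insert k R) = k"
        using finR Rk by (intro Max_eqI) (auto intro: less_imp_le)
      moreover from this have "Max (insert 0 (insert k R)) < Suc k"
        using finR by (subst Max_insert) auto
      ultimately show ?thesis
        using True less.hyps[of "insert k R"] MS finR \<open>k \<ge> 1\<close> by fastforce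
    next
      case False
      then have "is_peak_poly (insert k R) 0" by (simp add: is_peak_poly_def)
      then show ?thesis using \<open>k \<ge> 1\<close> by (intro exI[of _ 0]) simp
    qed
    then obtain q where q: "is_peak_poly (insert k R) q" "degree q < k" by blast
    let ?r = "smult (poly p (real k)) (gbinomial_poly k) - smult 2 p - q"
    \<comment> \<open>Up to the factor \<open>1 / fact k\<close> this is the leading coefficient of
      \<open>?r\<close>; if it were zero, \<open>peak_count R k\<close> would vanish.\<close>
    have "poly p (real k) \<noteq> 0"
      using p(1) Rk0 Rk \<open>k \<ge> 1\<close> unfolding is_peak_poly_def by force
    then have "degree (smult (poly p (real k)) (gbinomial_poly k)) = k"
      by (simp add: degree_gbinomial_poly)
    moreover have "degree (smult 2 p + q) < k"
      using degp q(2) by (intro degree_add_less) auto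
    ultimately have "degree (smult (poly p (real k)) (gbinomial_poly k) + - (smult 2 p + q)) = k"
      by (subst degree_add_eq_left) (simp_all only: degree_minus)
    then have "degree ?r = k" by (simp add: algebra_simps)
    moreover have "is_peak_poly S ?r"
      unfolding S using finR Rk \<open>k \<ge> 1\<close> p(1) q(1) by (intro is_peak_poly_step) auto
    ultimately show ?thesis using False m by auto
  qed
qed

theorem theorem1p1:
  fixes S :: "nat set"
  assumes "finite S" and "\<forall>i\<in>S. i > 0" and "admissible S"
  shows "\<exists>p :: real poly.
    (\<forall>k :: int. poly p (of_int k) \<in> \<int>) \<and>
    (\<forall>n\<ge>1. card (perms_with_peak_set S n) \<noteq> 0 \<longrightarrow>
      real (card (perms_with_peak_set S n)) =
        poly p (real n) * 2 powi (int n - int (card S) - 1)) \<and>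
    (S \<noteq> {} \<longrightarrow> degree p = Max S - 1) \<and>
    (S = {} \<longrightarrow> degree p = 0)"
proof -
  obtain m where "peak_count S m \<noteq> 0"
    using assms(3) by (auto simp: admissible_def card_perms_with_peak_set)
  then obtain p where p: "is_peak_poly S p" "degree p = (if S = {} then 0 else Max S - 1)"
    using exists_peak_poly[OF assms(1)] by blast
  \<comment> \<open>A nonzero count forces the guard in \<open>is_peak_poly\<close>, since every
    peak lies before the last position.\<close>
  have "\<forall>i\<in>S. i < n" if "peak_count S n \<noteq> 0" for n
    using that by (elim peak_count_nonzeroE) (auto dest: list_peaks_bounds)
  then show ?thesis
    using p unfolding is_peak_poly_def card_perms_with_peak_set by (intro exI[of _ p]) auto
qed

end
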